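(* Let $\varepsilon>0$ and let $\mathcal{P}\subseteq[0,1]^E$ be a packing polytope. Consider the online algorithm for the fractional submodular objectives chasing problem that sets $\vec{x}^0=\vec{0}$ and, at each time $t$, reveals the polytope $\mathcal{K}_t\triangleq\mathcal{P}_t\cap\{\vec{x}\in\mathbb{R}^E_+\mid f_t^*(\vec{x})\ge V_t\}$ to the positive-body chasing algorithm $\mathcal{B}_\varepsilon$ described in the context and outputs the vector $\vec{x}^t$ that $\mathcal{B}_\varepsilon$ returns. This algorithm is a deterministic $(1-1/e-\varepsilon)$-approximate, $O(\varepsilon^{-1}\log(\max_t|E_t|\cdot\varepsilon^{-1}))$-competitive algorithm for the fractional submodular objectives chasing problem. Moreover, its outputs satisfy the stronger approximation guarantee $F_t(\vec{1}-\exp(-\vec{x}^t))\ge(1-1/e-\varepsilon)\cdot V_t$ for all $t$.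
   Context: A packing polytope is one of the form $\{\vec{x}\in\mathbb{R}^E_+\mid P\vec{x}\le\vec{1}\}$ for a non-negative matrix $P$. For a set function $g$ on ground set $U$: $g(i\mid S)\triangleq g(S\cup\{i\})-g(S)$; multilinear extension $G(\vec{x})=\sum_{S\subseteq U}g(S)\prod_{i\in S}x_i\prod_{i\notin S}(1-x_i)$; coverage extension $g^*(\vec{x})=\min_{S\subseteq U}\big(g(S)+\sum_{i\in U}g(i\mid S)x_i\big)$; $\vec{1}-\exp(-\vec{x})$ has coordinates $1-\exp(-x_i)$. Fractional submodular objectives chasing problem: a polytope $\mathcal{P}\subseteq[0,1]^E$ is given up front. At each time $t=1,\dots,T$, a set $E_t\subseteq E$ is revealed, defining $\mathcal{P}_t\triangleq\mathcal{P}\cap\{\vec{x}\mid x_i=0\ \forall i\notin E_t\}$, together with a non-negative monotone submodular $f_t\colon 2^{E_t}\to\mathbb{R}_+$ (with multilinear extension $F_t$ and coverage extension $f_t^*$, coordinates outside $E_t$ being zero) and a value $V_t\le OPT_t\triangleq\max\{f_t(S)\mid S\subseteq E_t,\ \mathds{1}_S\in\mathcal{P}_t\}$. Before time $t+1$ the algorithm outputs $\vec{x}^t\in\mathcal{P}_t$. It is $\alpha$-approximate if $\mathbb{E}[F_t(\vec{x}^t)]\ge\alpha V_t$ for all $t$, and $c$-competitive (in recourse) if $\sum_{t=1}^T\|\vec{x}^t-\vec{x}^{t-1}\|_1\le c\cdot OPT_R$ (with $\vec{x}^0=\vec{0}$), where $OPT_R\triangleq\min\sum_{t=1}^T\|\mathds{1}_{S_t}-\mathds{1}_{S_{t-1}}\|_1$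 over sequences $S_0=\emptyset$ and $S_t\subseteq E_t$ with $\mathds{1}_{S_t}\in\mathcal{P}_t$ and $f_t(S_t)\ge V_t$ for all $t\ge1$. Positive-body chasing algorithm $\mathcal{B}_\varepsilon$ (a known result of Bhattacharya et al.): a deterministic online algorithm which, given a sequence of non-empty packing-covering polytopes $\mathcal{K}_t=\{\vec{x}\in\mathbb{R}^E_+\mid C^t\vec{x}\ge\vec{1},\ P^t\vec{x}\le\vec{1}\}$ ($C^t,P^t$ non-negative matrices), outputs at each time $t$ a point $\vec{x}^t$ with $C^t\vec{x}^t\ge(1-\varepsilon)\vec{1}$ and $P^t\vec{x}^t\le\vec{1}$, with total recourse $\sum_t\|\vec{x}^t-\vec{x}^{t-1}\|_1=O(\varepsilon^{-1}\log(d\varepsilon^{-1}))\cdot\min_{\vec{y}^t\in\mathcal{K}_t\,\forall t}\sum_t\|\vec{y}^t-\vec{y}^{t-1}\|_1$, where $d$ is the maximum number of non-zero coefficients in any covering constraint. (The polytope $\mathcal{K}_t$ above is a packing-covering polytope whose covering constraints are $f_t(S)+\sum_{i\in E_t}f_t(i\mid S)x_i\ge V_t$, $S\subseteq E_t$.)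
   Formalization: It is additionally assumed that ε ≤ 1−1/e or that all V_t ≥ 0 (otherwise the claim fails, e.g. f_t = 0, V_t = −1, ε = 1); the log in the O-bounds is read as max(1, ln). *)

theory Defs
  imports "HOL-Analysis.Analysis"
begin

text \<open>
  The ground set \<open>E\<close> is the finite type \<open>'e\<close>, so that \<open>real ^ 'e\<close> is the space of vectors indexed
  by \<open>E\<close>.  A non-negative matrix is represented by the finite set of its rows, since the number of
  rows varies over time.  Times are \<open>1, \<dots>, T\<close>; the data revealed at time \<open>t\<close> is the list entry
  at position \<open>t - 1\<close>.
\<close>

definition l1_norm :: "real ^ 'e::finite \<Rightarrow> real" where
  "l1_norm x = (\<Sum>i\<in>UNIV. \<bar>x $ i\<bar>)"

definition indicator_vec :: "'e::finite set \<Rightarrow> real ^ 'e" where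
  "indicator_vec S = (\<chi> i. if i \<in> S then 1 else 0)"

definition one_minus_exp :: "real ^ 'e::finite \<Rightarrow> real ^ 'e" where
  "one_minus_exp x = (\<chi> i. 1 - exp (- (x $ i)))"

definition total_recourse :: "(nat \<Rightarrow> real ^ 'e::finite) \<Rightarrow> nat \<Rightarrow> real" where
  "total_recourse x T = (\<Sum>t = 1..T. l1_norm (x t - x (t - 1)))"

text \<open>
  The logarithm inside an \<open>O\<close>-bound is truncated below at 1, so that the bound is meaningful for
  all arguments (also where \<open>ln z\<close> is close to zero or negative).
\<close>

definition olog :: "real \<Rightarrow> real" where
  "olog z = max 1 (ln z)"

section \<open>Set functions\<close>

definition marginal :: "('e set \<Rightarrow> real) \<Rightarrow> 'e \<Rightarrow> 'e set \<Rightarrow> real" where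
  "marginal g i S = g (S \<union> {i}) - g S"

definition submodular_on :: "'e set \<Rightarrow> ('e set \<Rightarrow> real) \<Rightarrow> bool" where
  "submodular_on U g \<longleftrightarrow>
     (\<forall>A B. A \<subseteq> U \<longrightarrow> B \<subseteq> U \<longrightarrow> g (A \<union> B) + g (A \<inter> B) \<le> g A + g B)"

definition multilinear_ext :: "'e::finite set \<Rightarrow> ('e set \<Rightarrow> real) \<Rightarrow> real ^ 'e \<Rightarrow> real" where
  "multilinear_ext U g x =
     (\<Sum>S\<in>Pow U. g S * (\<Prod>i\<in>S. x $ i) * (\<Prod>i\<in>U - S. 1 - x $ i))"

definition coverage_ext :: "'e::finite set \<Rightarrow> ('e set \<Rightarrow> real) \<Rightarrow> real ^ 'e \<Rightarrow> real" where
  "coverage_ext U g x = Min ((\<lambda>S. g S + (\<Sum>i\<in>U. marginal g i S * x $ i)) ` Pow U)"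

section \<open>Deterministic online algorithms\<close>

text \<open>
  A deterministic online algorithm maps the non-empty list of all requests seen so far to its
  current output.  The initial point is the zero vector.
\<close>

definition trajectory ::
    "('r list \<Rightarrow> real ^ 'e::finite) \<Rightarrow> 'r list \<Rightarrow> nat \<Rightarrow> real ^ 'e" where
  "trajectory A rs t = (if t = 0 then 0 else A (take t rs))"

section \<open>Positive body chasing\<close>

text \<open>
  A description of the packing-covering polytope with covering rows \<open>C\<close> and packing rows \<open>P\<close> in
  the variables \<open>x\<^sub>i\<close> with \<open>i\<close> in \<open>body_vars\<close>; the remaining coordinates are fixed to zero.  A
  constraint \<open>x\<^sub>i = 0\<close> is the packing constraint \<open>x\<^sub>i \<le> 0\<close>, which cannot be normalised to
  right-hand side 1, hence the separate component.
\<close>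

datatype 'e body =
  Body (body_vars: "'e set") (cover_rows: "(real ^ 'e) set") (pack_rows: "(real ^ 'e) set")

definition nonneg_rows :: "(real ^ 'e::finite) set \<Rightarrow> bool" where
  "nonneg_rows M \<longleftrightarrow> finite M \<and> (\<forall>a\<in>M. 0 \<le> a)"

definition relaxed_body_points :: "real \<Rightarrow> 'e::finite body \<Rightarrow> (real ^ 'e) set" where
  "relaxed_body_points \<epsilon> K =
     {x. 0 \<le> x \<and> (\<forall>i. i \<notin> body_vars K \<longrightarrow> x $ i = 0) \<and>
         (\<forall>c\<in>cover_rows K. c \<bullet> x \<ge> 1 - \<epsilon>) \<and> (\<forall>p\<in>pack_rows K. p \<bullet> x \<le> 1)}"

definition body_points :: "'e::finite body \<Rightarrow> (real ^ 'e) set" where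
  "body_points K =
     {x. 0 \<le> x \<and> (\<forall>i. i \<notin> body_vars K \<longrightarrow> x $ i = 0) \<and>
         (\<forall>c\<in>cover_rows K. c \<bullet> x \<ge> 1) \<and> (\<forall>p\<in>pack_rows K. p \<bullet> x \<le> 1)}"

definition valid_body :: "'e::finite body \<Rightarrow> bool" where
  "valid_body K \<longleftrightarrow>
     nonneg_rows (cover_rows K) \<and> nonneg_rows (pack_rows K) \<and> body_points K \<noteq> {}"

definition covering_sparsity :: "'e::finite body list \<Rightarrow> nat" where
  "covering_sparsity Ks =
     Max (insert 0 ((\<lambda>c. card {i. c $ i \<noteq> 0}) ` (\<Union>K\<in>set Ks. cover_rows K)))"

definition opt_body_recourse :: "'e::finite body list \<Rightarrow> real" where
  "opt_body_recourse Ks =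
     Inf {total_recourse y (length Ks) | y.
            y 0 = 0 \<and> (\<forall>t\<in>{1..length Ks}. y t \<in> body_points (Ks ! (t - 1)))}"

text \<open>
  The guarantee of the positive body chasing algorithm with accuracy \<open>\<epsilon>\<close>, where \<open>c\<close> is the
  constant hidden in the \<open>O\<close>-notation.
\<close>

definition positive_body_chaser ::
    "real \<Rightarrow> real \<Rightarrow> ('e::finite body list \<Rightarrow> real ^ 'e) \<Rightarrow> bool" where
  "positive_body_chaser c \<epsilon> B \<longleftrightarrow>
     (\<forall>Ks. (\<forall>K\<in>set Ks. valid_body K) \<longrightarrow>
        (\<forall>t\<in>{1..length Ks}. trajectory B Ks t \<in> relaxed_body_points \<epsilon> (Ks ! (t - 1))) \<and>
        total_recourse (trajectory B Ks) (length Ks)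
          \<le> c * (1 / \<epsilon> * olog (real (covering_sparsity Ks) / \<epsilon>)) * opt_body_recourse Ks)"

section \<open>Fractional submodular objectives chasing\<close>

text \<open>
  A request consists of the set \<open>E\<^sub>t\<close>, the function \<open>f\<^sub>t\<close> (of which only the values on subsets of
  \<open>E\<^sub>t\<close> matter) and the value \<open>V\<^sub>t\<close>.
\<close>

datatype 'e request =
  Request (ground: "'e set") (objective: "'e set \<Rightarrow> real") (target: real)

definition packing_polytope :: "(real ^ 'e::finite) set \<Rightarrow> (real ^ 'e) set" where
  "packing_polytope M = {x. 0 \<le> x \<and> (\<forall>p\<in>M. p \<bullet> x \<le> 1)}"

definition restrict_polytope :: "(real ^ 'e::finite) set \<Rightarrow> 'e set \<Rightarrow> (real ^ 'e) set" where
  "restrict_polytope P U = P \<inter> {x. \<forall>i. i \<notin> U \<longrightarrow> x $ i = 0}"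

definition opt_value :: "(real ^ 'e::finite) set \<Rightarrow> 'e request \<Rightarrow> real" where
  "opt_value P r =
     Max (objective r ` {S. S \<subseteq> ground r \<and> indicator_vec S \<in> restrict_polytope P (ground r)})"

definition valid_request :: "(real ^ 'e::finite) set \<Rightarrow> 'e request \<Rightarrow> bool" where
  "valid_request P r \<longleftrightarrow>
     (\<forall>S. S \<subseteq> ground r \<longrightarrow> 0 \<le> objective r S) \<and>
     mono_on (Pow (ground r)) (objective r) \<and>
     submodular_on (ground r) (objective r) \<and>
     target r \<le> opt_value P r"

definition opt_recourse :: "(real ^ 'e::finite) set \<Rightarrow> 'e request list \<Rightarrow> real" where
  "opt_recourse P rs =
     Inf {total_recourse (\<lambda>t. indicator_vec (S t)) (length rs) | S.
            S 0 = {} \<and>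
            (\<forall>t\<in>{1..length rs}. let r = rs ! (t - 1) in
               S t \<subseteq> ground r \<and> indicator_vec (S t) \<in> restrict_polytope P (ground r) \<and>
               objective r (S t) \<ge> target r)}"

definition max_ground_size :: "'e request list \<Rightarrow> nat" where
  "max_ground_size rs = Max (insert 0 ((\<lambda>r. card (ground r)) ` set rs))"

definition feasible_outputs ::
    "(real ^ 'e::finite) set \<Rightarrow> 'e request list \<Rightarrow> (nat \<Rightarrow> real ^ 'e) \<Rightarrow> bool" where
  "feasible_outputs P rs x \<longleftrightarrow>
     (\<forall>t\<in>{1..length rs}. x t \<in> restrict_polytope P (ground (rs ! (t - 1))))"

definition approximate_on ::
    "real \<Rightarrow> 'e::finite request list \<Rightarrow> (nat \<Rightarrow> real ^ 'e) \<Rightarrow> bool" where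
  "approximate_on \<alpha> rs x \<longleftrightarrow>
     (\<forall>t\<in>{1..length rs}. let r = rs ! (t - 1) in
        multilinear_ext (ground r) (objective r) (x t) \<ge> \<alpha> * target r)"

definition competitive_on ::
    "real \<Rightarrow> (real ^ 'e::finite) set \<Rightarrow> 'e request list \<Rightarrow> (nat \<Rightarrow> real ^ 'e) \<Rightarrow> bool" where
  "competitive_on c P rs x \<longleftrightarrow> total_recourse x (length rs) \<le> c * opt_recourse P rs"

section \<open>The algorithm\<close>

text \<open>
  The polytope revealed to the positive body chasing algorithm is
  \<open>P\<^sub>t \<inter> {x \<ge> 0. f\<^sub>t\<^sup>*(x) \<ge> V\<^sub>t}\<close>.
\<close>

definition chasing_polytope :: "(real ^ 'e::finite) set \<Rightarrow> 'e request \<Rightarrow> (real ^ 'e) set" where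
  "chasing_polytope P r =
     restrict_polytope P (ground r) \<inter>
     {x. 0 \<le> x \<and> coverage_ext (ground r) (objective r) x \<ge> target r}"

text \<open>
  Its description as a packing-covering polytope: the covering constraint
  \<open>f(S) + (\<Sum>i\<in>U. f(i | S) x\<^sub>i) \<ge> V\<close> is normalised by dividing by \<open>V - f(S)\<close>; it is vacuous and
  omitted if \<open>f(S) \<ge> V\<close>.
\<close>

definition cover_row :: "'e::finite request \<Rightarrow> 'e set \<Rightarrow> real ^ 'e" where
  "cover_row r S =
     (\<chi> i. if i \<in> ground r
           then marginal (objective r) i S / (target r - objective r S) else 0)"

definition chasing_body :: "(real ^ 'e::finite) set \<Rightarrow> 'e request \<Rightarrow> 'e body" where
  "chasing_body M r =
     Body (ground r) (cover_row r ` {S. S \<subseteq> ground r \<and> objective r S < target r}) M"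

lemma body_points_chasing_body:
  fixes r :: "'e::finite request"
  assumes mono: "mono_on (Pow (ground r)) (objective r)"
  shows "body_points (chasing_body M r) = chasing_polytope (packing_polytope M) r"
proof -
  let ?U = "ground r" and ?f = "objective r" and ?V = "target r"
  have row: "cover_row r S \<bullet> x \<ge> 1 \<longleftrightarrow> ?f S + (\<Sum>i\<in>?U. marginal ?f i S * x $ i) \<ge> ?V"
    if "?f S < ?V" for S x
  proof -
    have "cover_row r S \<bullet> x = (\<Sum>i\<in>?U. marginal ?f i S / (?V - ?f S) * x $ i)"
      by (simp add: inner_vec_def cover_row_def if_distrib[of "\<lambda>z. z * _"] sum.If_cases
               cong: if_cong)
    also have "\<dots> = (\<Sum>i\<in>?U. marginal ?f i S * x $ i) / (?V - ?f S)"
      by (simp add: sum_divide_distrib)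
    finally have eq: "cover_row r S \<bullet> x = \<dots>" .
    show ?thesis unfolding eq using that by (simp add: pos_le_divide_eq algebra_simps)
  qed
  have vac: "?f S + (\<Sum>i\<in>?U. marginal ?f i S * x $ i) \<ge> ?V"
    if "S \<subseteq> ?U" "\<not> ?f S < ?V" "0 \<le> x" for S x
  proof -
    have "0 \<le> marginal ?f i S * x $ i" if "i \<in> ?U" for i
    proof -
      have "?f S \<le> ?f (S \<union> {i})"
        using mono \<open>S \<subseteq> ?U\<close> that by (intro mono_onD[OF mono]) auto
      then show ?thesis using \<open>0 \<le> x\<close> by (auto simp: marginal_def less_eq_vec_def)
    qed
    then have "0 \<le> (\<Sum>i\<in>?U. marginal ?f i S * x $ i)" by (rule sum_nonneg)
    then show ?thesis using that by linarith
  qed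
  have cov: "coverage_ext ?U ?f x \<ge> ?V \<longleftrightarrow>
      (\<forall>S. S \<subseteq> ?U \<longrightarrow> ?f S + (\<Sum>i\<in>?U. marginal ?f i S * x $ i) \<ge> ?V)" for x
    unfolding coverage_ext_def by (subst Min_ge_iff) auto
  have "(\<forall>c\<in>cover_row r ` {S. S \<subseteq> ?U \<and> ?f S < ?V}. c \<bullet> x \<ge> 1) \<longleftrightarrow> coverage_ext ?U ?f x \<ge> ?V"
    if "0 \<le> x" for x
    unfolding cov using row vac that by blast
  then show ?thesis
    by (auto simp: body_points_def chasing_body_def chasing_polytope_def restrict_polytope_def
        packing_polytope_def)
qed

definition chasing_algorithm ::
    "('e::finite body list \<Rightarrow> real ^ 'e) \<Rightarrow> (real ^ 'e) set \<Rightarrow> 'e request list \<Rightarrow> real ^ 'e" where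
  "chasing_algorithm B M rs = B (map (chasing_body M) rs)"

end

theory Submission
  imports Defs
begin

text \<open>
  Put \<open>y\<^sub>i(s) = 1 - exp (- s x\<^sub>i)\<close> and let \<open>R(s)\<close> be the random subset containing each \<open>i\<close>
  independently with probability \<open>y\<^sub>i(s)\<close>.  Since \<open>y\<^sub>i' = x\<^sub>i (1 - y\<^sub>i)\<close>, the function
  \<open>\<phi>(s) = F(y(s))\<close> has derivative \<open>E[\<Sum>\<^sub>i x\<^sub>i f(i | R(s))]\<close>, and the relaxed covering constraints
  for the sets \<open>R(s)\<close> bound it from below by \<open>(1 - \<epsilon>) (V - \<phi>(s))\<close>.  Hence
  \<open>\<phi>(1) \<ge> (1 - exp (\<epsilon> - 1)) V \<ge> (1 - 1/e - \<epsilon>) V\<close>.  The bound for \<open>F(x)\<close> itself follows from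
  monotonicity and \<open>1 - exp (- x\<^sub>i) \<le> x\<^sub>i\<close>.  For the recourse, submodularity puts every integral
  solution with \<open>f(S) \<ge> V\<close> into the chased polytope, so the fractional optimum is at most the
  integral one.
\<close>

section \<open>Multilinear extensions\<close>

lemma multilinear_ext_empty [simp]: "multilinear_ext {} g x = g {}"
  by (simp add: multilinear_ext_def)

text \<open>Conditioning on whether \<open>a\<close> belongs to the random set; this recursion
  drives the inductions on \<open>U\<close> below.\<close>

lemma multilinear_ext_insert:
  assumes "a \<notin> U"
  shows "multilinear_ext (insert a U) g x =
    (1 - x $ a) * multilinear_ext U g x + x $ a * multilinear_ext U (\<lambda>S. g (insert a S)) x"
proof -
  let ?h = "\<lambda>S. g S * (\<Prod>i\<in>S. x $ i) * (\<Prod>i\<in>insert a U - S. 1 - x $ i)"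
  have inj: "inj_on (insert a) (Pow U)"
    using assms by (auto simp: inj_on_def)
  have "multilinear_ext (insert a U) g x = sum ?h (Pow U) + sum ?h (insert a ` Pow U)"
    unfolding multilinear_ext_def Pow_insert using assms by (intro sum.union_disjoint) auto
  also have "sum ?h (insert a ` Pow U) = (\<Sum>S\<in>Pow U. ?h (insert a S))"
    by (simp add: sum.reindex[OF inj])
  also have "\<dots> = x $ a * multilinear_ext U (\<lambda>S. g (insert a S)) x"
    unfolding multilinear_ext_def sum_distrib_left
  proof (intro sum.cong refl)
    fix S assume "S \<in> Pow U"
    then have "a \<notin> S" "insert a U - insert a S = U - S" using assms by auto
    then show "?h (insert a S) =
        x $ a * (g (insert a S) * (\<Prod>i\<in>S. x $ i) * (\<Prod>i\<in>U - S. 1 - x $ i))" by simp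
  qed
  also have "sum ?h (Pow U) = (1 - x $ a) * multilinear_ext U g x"
    unfolding multilinear_ext_def sum_distrib_left
  proof (intro sum.cong refl)
    fix S assume "S \<in> Pow U"
    then have "insert a U - S = insert a (U - S)" using assms by auto
    then show "?h S = (1 - x $ a) * (g S * (\<Prod>i\<in>S. x $ i) * (\<Prod>i\<in>U - S. 1 - x $ i))"
      using assms by simp
  qed
  finally show ?thesis .
qed

lemma multilinear_ext_const [simp]: "multilinear_ext U (\<lambda>S. c) x = c"
  using finite[of U]
  by (induction U rule: finite_induct) (simp_all add: multilinear_ext_insert algebra_simps)

lemma multilinear_ext_add:
  "multilinear_ext U (\<lambda>S. g S + h S) x = multilinear_ext U g x + multilinear_ext U h x"
  by (simp add: multilinear_ext_def sum.distrib algebra_simps)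

lemma multilinear_ext_diff:
  "multilinear_ext U (\<lambda>S. g S - h S) x = multilinear_ext U g x - multilinear_ext U h x"
  by (simp add: multilinear_ext_def sum_subtractf algebra_simps)

lemma multilinear_ext_cmult:
  "multilinear_ext U (\<lambda>S. k * g S) x = k * multilinear_ext U g x"
  by (simp add: multilinear_ext_def sum_distrib_left algebra_simps)

lemma multilinear_ext_mono_fun:
  assumes "\<And>i. i \<in> U \<Longrightarrow> 0 \<le> x $ i \<and> x $ i \<le> 1"
    and "\<And>S. S \<subseteq> U \<Longrightarrow> g S \<le> h S"
  shows "multilinear_ext U g x \<le> multilinear_ext U h x"
  unfolding multilinear_ext_def
  using assms by (intro sum_mono mult_right_mono prod_nonneg) (auto simp: subset_iff)

lemma multilinear_ext_mono:
  assumes "mono_on (Pow U) g"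
    and "\<And>i. i \<in> U \<Longrightarrow> 0 \<le> x $ i \<and> x $ i \<le> y $ i \<and> y $ i \<le> 1"
  shows "multilinear_ext U g x \<le> multilinear_ext U g y"
  using finite[of U] assms
proof (induction U arbitrary: g rule: finite_induct)
  case (insert a U)
  have a: "0 \<le> x $ a" "x $ a \<le> y $ a" "y $ a \<le> 1" using insert.prems by auto
  have U: "0 \<le> y $ i \<and> y $ i \<le> 1" if "i \<in> U" for i
    using insert.prems(2)[of i] that by auto
  have "mono_on (Pow U) g" "mono_on (Pow U) (\<lambda>S. g (insert a S))"
    by (intro mono_onI mono_onD[OF insert.prems(1)]; blast)+
  then have IH: "multilinear_ext U g x \<le> multilinear_ext U g y"
    "multilinear_ext U (\<lambda>S. g (insert a S)) x \<le> multilinear_ext U (\<lambda>S. g (insert a S)) y"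
    using insert by auto
  have "g S \<le> g (insert a S)" if "S \<subseteq> U" for S
    using that by (intro mono_onD[OF insert.prems(1)]) auto
  then have le: "multilinear_ext U g y \<le> multilinear_ext U (\<lambda>S. g (insert a S)) y"
    by (intro multilinear_ext_mono_fun U)
  \<comment> \<open>Interpolation: first the coordinates in \<open>U\<close> move from
    \<open>x\<close> to \<open>y\<close> with \<open>x $ a\<close> kept, then \<open>x $ a\<close>
    rises to \<open>y $ a\<close>, which \<open>le\<close> makes profitable.\<close>
  have "multilinear_ext (insert a U) g x \<le>
      (1 - x $ a) * multilinear_ext U g y + x $ a * multilinear_ext U (\<lambda>S. g (insert a S)) y"
    unfolding multilinear_ext_insert[OF insert.hyps(2)]
    using a IH by (intro add_mono mult_left_mono) auto
  also have "\<dots> \<le> multilinear_ext (insert a U) g y"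
    unfolding multilinear_ext_insert[OF insert.hyps(2)]
    using mult_right_mono[OF a(2), of "multilinear_ext U (\<lambda>S. g (insert a S)) y - multilinear_ext U g y"] le
    by (simp add: algebra_simps)
  finally show ?case .
qed simp

section \<open>Growth along the curve \<open>1 - exp (- s x)\<close>\<close>

lemma one_minus_exp_bounds:
  assumes "0 \<le> x"
  shows "0 \<le> one_minus_exp x $ i" "one_minus_exp x $ i \<le> x $ i" "one_minus_exp x $ i \<le> 1"
  using assms exp_ge_add_one_self[of "- (x $ i)"] by (auto simp: one_minus_exp_def less_eq_vec_def)

text \<open>The partial derivative in direction \<open>i\<close> is the mean gain from forcing
  \<open>i\<close> in over forcing it out, and the chain rule factor \<open>1 - y_i\<close> is the
  probability that \<open>i\<close> is missing. As a present element has marginal 0, their product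
  is the mean marginal at the random set itself.\<close>

lemma has_real_derivative_multilinear_ext_one_minus_exp:
  "((\<lambda>s. multilinear_ext U g (one_minus_exp (s *\<^sub>R x))) has_real_derivative
      multilinear_ext U (\<lambda>R. \<Sum>i\<in>U. marginal g i R * x $ i) (one_minus_exp (s *\<^sub>R x))) (at s)"
  using finite[of U]
proof (induction U arbitrary: g rule: finite_induct)
  case (insert a U)
  let ?y = "\<lambda>s. one_minus_exp (s *\<^sub>R x)"
  let ?ga = "\<lambda>S. g (insert a S)"
  let ?F = "multilinear_ext U"
  let ?L = "\<lambda>g R. \<Sum>i\<in>U. marginal g i R * x $ i"
  have y: "((\<lambda>s. ?y s $ a) has_real_derivative x $ a * (1 - ?y s $ a)) (at s)"
    unfolding one_minus_exp_def by (auto intro!: derivative_eq_intros)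
  have "((\<lambda>s. (1 - ?y s $ a) * ?F g (?y s) + ?y s $ a * ?F ?ga (?y s)) has_real_derivative
      (1 - ?y s $ a) * (?F (?L g) (?y s) + (?F ?ga (?y s) - ?F g (?y s)) * x $ a)
        + ?y s $ a * ?F (?L ?ga) (?y s)) (at s)"
    by (rule derivative_eq_intros y insert.IH refl)+ (simp add: algebra_simps)
  \<comment> \<open>The new marginal sum, first with \<open>a\<close> absent and then with
    \<open>a\<close> present; in the latter case the term of \<open>a\<close> is 0, so it enters
    with weight \<open>1 - y_a\<close> only.\<close>
  moreover have "(\<Sum>i\<in>insert a U. marginal g i R * x $ i) = ?L g R + x $ a * (?ga R - g R)" for R
    using insert.hyps by (simp add: marginal_def algebra_simps)
  moreover have "(\<Sum>i\<in>insert a U. marginal g i (insert a R) * x $ i) = ?L ?ga R" for R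
    using insert.hyps by (simp add: marginal_def insert_commute)
  ultimately show ?case
    unfolding multilinear_ext_insert[OF insert.hyps(2)]
    by (simp add: multilinear_ext_add multilinear_ext_diff multilinear_ext_cmult mult.commute)
qed simp

text \<open>A Groenwall argument: averaging \<open>marg\<close> over the random set gives
  \<open>\<phi>' \<ge> k (V - \<phi>)\<close>, so \<open>exp (k s) (\<phi> s - V)\<close> is
  nondecreasing on the unit interval.\<close>

lemma multilinear_ext_one_minus_exp_ge:
  fixes x :: "real ^ 'e::finite"
  assumes "0 \<le> x" and "0 \<le> g {}"
    and marg: "\<And>R. R \<subseteq> U \<Longrightarrow> (\<Sum>i\<in>U. marginal g i R * x $ i) \<ge> k * (V - g R)"
  shows "multilinear_ext U g (one_minus_exp x) \<ge> (1 - exp (- k)) * V"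
proof -
  define \<phi> where "\<phi> s = multilinear_ext U g (one_minus_exp (s *\<^sub>R x))" for s
  define \<phi>' where
    "\<phi>' s = multilinear_ext U (\<lambda>R. \<Sum>i\<in>U. marginal g i R * x $ i) (one_minus_exp (s *\<^sub>R x))" for s
  have deriv: "(\<phi> has_real_derivative \<phi>' s) (at s)" for s
    unfolding \<phi>_def \<phi>'_def by (rule has_real_derivative_multilinear_ext_one_minus_exp)
  have ge: "\<phi>' s \<ge> k * (V - \<phi> s)" if "0 \<le> s" for s
  proof -
    have "0 \<le> s *\<^sub>R x" using \<open>0 \<le> x\<close> that by (simp add: less_eq_vec_def)
    then have "multilinear_ext U (\<lambda>R. k * (V - g R)) (one_minus_exp (s *\<^sub>R x)) \<le> \<phi>' s"
      unfolding \<phi>'_def by (intro multilinear_ext_mono_fun marg) (auto simp: one_minus_exp_bounds)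
    then show ?thesis
      unfolding \<phi>_def by (simp add: multilinear_ext_cmult multilinear_ext_diff)
  qed
  have "exp (k * 0) * (\<phi> 0 - V) \<le> exp (k * 1) * (\<phi> 1 - V)"
  proof (rule DERIV_nonneg_imp_nondecreasing[of 0 1])
    fix s :: real assume s: "0 \<le> s" "s \<le> 1"
    have "((\<lambda>s. exp (k * s) * (\<phi> s - V)) has_real_derivative
        exp (k * s) * (\<phi>' s - k * (V - \<phi> s))) (at s)"
      by (rule derivative_eq_intros deriv refl)+ (simp add: algebra_simps)
    then show "\<exists>d. ((\<lambda>s. exp (k * s) * (\<phi> s - V)) has_real_derivative d) (at s) \<and> 0 \<le> d"
      using ge[OF s(1)] by (intro exI conjI) auto
  qed simp
  moreover have "\<phi> 0 = g {}"
  proof -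
    have "multilinear_ext U g 0 = g {}" using finite[of U]
      by (induction U rule: finite_induct) (simp_all add: multilinear_ext_insert)
    moreover have "one_minus_exp 0 = (0 :: real ^ 'e)"
      by (simp add: one_minus_exp_def vec_eq_iff)
    ultimately show ?thesis by (simp add: \<phi>_def)
  qed
  ultimately have "exp k * (\<phi> 1 - V) \<ge> - V" using \<open>0 \<le> g {}\<close> by simp
  then have "exp (- k) * (exp k * (\<phi> 1 - V)) \<ge> exp (- k) * - V"
    by (intro mult_left_mono) auto
  then have "\<phi> 1 - V \<ge> - exp (- k) * V"
    by (simp add: mult.assoc[symmetric] exp_add[symmetric])
  then show ?thesis by (simp add: \<phi>_def algebra_simps)
qed

text \<open>Lowering the exponent from 1 to \<open>1 - \<epsilon>\<close> costs
  \<open>exp (\<epsilon> - 1) * (1 - exp (- \<epsilon>))\<close>, whose factors are at most 1 and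
  \<open>\<epsilon>\<close>.\<close>

lemma one_minus_exp_ratio_ge:
  fixes \<epsilon> :: real
  assumes "0 \<le> \<epsilon>" "\<epsilon> \<le> 1"
  shows "1 - 1 / exp 1 - \<epsilon> \<le> 1 - exp (- (1 - \<epsilon>))"
proof -
  have "exp (\<epsilon> - 1) - exp (- 1) = exp (\<epsilon> - 1) * (1 - exp (- \<epsilon>))"
    by (simp add: algebra_simps exp_add[symmetric])
  also have "\<dots> \<le> 1 * \<epsilon>"
    using assms exp_ge_add_one_self[of "- \<epsilon>"] by (intro mult_mono) auto
  finally show ?thesis by (simp add: exp_minus inverse_eq_divide)
qed

section \<open>The chased bodies\<close>

text \<open>The elements of \<open>T\<close> are added one at a time; by submodularity each gains at
  most what it gains over \<open>S\<close> alone.\<close>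

lemma submodular_on_marginal_sum:
  assumes "submodular_on U g" "finite T" "S \<subseteq> U" "T \<subseteq> U"
  shows "g (S \<union> T) \<le> g S + (\<Sum>i\<in>T. marginal g i S)"
  using assms(2,4)
proof (induction T rule: finite_induct)
  case (insert a T)
  have "(S \<union> T) \<inter> (S \<union> {a}) = S" "(S \<union> T) \<union> (S \<union> {a}) = S \<union> insert a T"
    using insert.hyps by auto
  moreover have "g ((S \<union> T) \<union> (S \<union> {a})) + g ((S \<union> T) \<inter> (S \<union> {a})) \<le> g (S \<union> T) + g (S \<union> {a})"
    by (rule assms(1)[unfolded submodular_on_def, rule_format]) (use assms(3) insert.prems in auto)
  ultimately show ?case using insert by (simp add: marginal_def)
qed simp

lemma marginal_nonneg:
  assumes "mono_on (Pow U) g" "S \<subseteq> U" "i \<in> U"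
  shows "0 \<le> marginal g i S"
  unfolding marginal_def using assms by (auto intro!: mono_onD[OF assms(1)])

lemma cover_row_inner:
  "cover_row r S \<bullet> x =
    (\<Sum>i\<in>ground r. marginal (objective r) i S * x $ i) / (target r - objective r S)"
  by (simp add: inner_vec_def cover_row_def if_distrib[of "\<lambda>z. z * _"] sum.If_cases
      sum_divide_distrib cong: if_cong)

text \<open>Integral solutions embed into the chased bodies, which gives both nonemptiness and the
  comparison of optima. For any \<open>A\<close>, monotonicity gives
  \<open>V \<le> f (A \<union> S)\<close>, and submodularity bounds this by the covering expression
  of \<open>A\<close>.\<close>

lemma indicator_vec_in_chasing_body:
  assumes "mono_on (Pow (ground r)) (objective r)" "submodular_on (ground r) (objective r)"
    and "S \<subseteq> ground r" "indicator_vec S \<in> restrict_polytope (packing_polytope M) (ground r)"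
    and "target r \<le> objective r S"
  shows "indicator_vec S \<in> body_points (chasing_body M r)"
proof -
  let ?f = "objective r" and ?U = "ground r"
  have "target r \<le> ?f A + (\<Sum>i\<in>?U. marginal ?f i A * indicator_vec S $ i)" if "A \<subseteq> ?U" for A
  proof -
    have "target r \<le> ?f (A \<union> S)"
      using assms(3,5) that mono_onD[OF assms(1), of S "A \<union> S"] by auto
    also have "\<dots> \<le> ?f A + (\<Sum>i\<in>S. marginal ?f i A)"
      using assms(2,3) that by (intro submodular_on_marginal_sum) auto
    also have "(\<Sum>i\<in>S. marginal ?f i A) = (\<Sum>i\<in>?U. marginal ?f i A * indicator_vec S $ i)"
      using assms(3) by (intro sum.mono_neutral_cong_left) (auto simp: indicator_vec_def)
    finally show ?thesis .
  qed
  then have "target r \<le> coverage_ext ?U ?f (indicator_vec S)"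
    unfolding coverage_ext_def by (subst Min_ge_iff) auto
  then show ?thesis
    unfolding body_points_chasing_body[OF assms(1)] chasing_polytope_def
    using assms(4) by (auto simp: restrict_polytope_def packing_polytope_def)
qed

lemma valid_request_witness:
  fixes r :: "'e::finite request"
  assumes "valid_request (packing_polytope M) r"
  obtains S where "S \<subseteq> ground r"
    "indicator_vec S \<in> restrict_polytope (packing_polytope M) (ground r)"
    "target r \<le> objective r S"
proof -
  let ?D = "{S. S \<subseteq> ground r \<and> indicator_vec S \<in> restrict_polytope (packing_polytope M) (ground r)}"
  \<comment> \<open>\<open>Max\<close> is attained only on a nonempty family; the empty set is a
    candidate since the zero vector meets every packing row.\<close>
  have "indicator_vec {} = (0 :: real ^ 'e)" by (simp add: indicator_vec_def vec_eq_iff)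
  then have "{} \<in> ?D" by (simp add: restrict_polytope_def packing_polytope_def)
  then have "Max (objective r ` ?D) \<in> objective r ` ?D" by (intro Max_in) auto
  then show ?thesis
    using assms that unfolding valid_request_def opt_value_def by auto
qed

lemma valid_body_chasing_body:
  assumes "nonneg_rows M" "valid_request (packing_polytope M) r"
  shows "valid_body (chasing_body M r)"
proof -
  have mono: "mono_on (Pow (ground r)) (objective r)"
    and sub: "submodular_on (ground r) (objective r)"
    using assms(2) by (auto simp: valid_request_def)
  obtain S where "S \<subseteq> ground r"
    "indicator_vec S \<in> restrict_polytope (packing_polytope M) (ground r)"
    "target r \<le> objective r S"
    using assms(2) by (rule valid_request_witness)
  then have "indicator_vec S \<in> body_points (chasing_body M r)"
    by (rule indicator_vec_in_chasing_body[OF mono sub])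
  then have "body_points (chasing_body M r) \<noteq> {}" by blast
  moreover have "nonneg_rows (cover_rows (chasing_body M r))"
    by (auto simp: nonneg_rows_def chasing_body_def cover_row_def less_eq_vec_def
        intro!: divide_nonneg_nonneg marginal_nonneg[OF mono])
  ultimately show ?thesis
    using assms(1) by (simp add: valid_body_def chasing_body_def)
qed

text \<open>Covering rows vanish outside the ground set of their request; this turns the sparsity in
  the guarantee of \<open>B\<close> into a bound on ground sets.\<close>

lemma covering_sparsity_chasing_body_le:
  "covering_sparsity (map (chasing_body M) rs) \<le> max_ground_size rs"
proof -
  have fin: "finite ((\<lambda>c. card {i. c $ i \<noteq> 0}) `
      (\<Union>K\<in>set (map (chasing_body M) rs). cover_rows K))"
    by (auto simp: chasing_body_def)
  have "card {i. cover_row r S $ i \<noteq> 0} \<le> max_ground_size rs" if "r \<in> set rs" for r S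
  proof -
    have "card {i. cover_row r S $ i \<noteq> 0} \<le> card (ground r)"
      by (intro card_mono) (auto simp: cover_row_def)
    also have "\<dots> \<le> max_ground_size rs"
      unfolding max_ground_size_def using that by (intro Max_ge) auto
    finally show ?thesis .
  qed
  then show ?thesis
    unfolding covering_sparsity_def using fin
    by (subst Max_le_iff) (auto simp: chasing_body_def)
qed

section \<open>Comparison of the two recourse optima\<close>

lemma total_recourse_nonneg: "0 \<le> total_recourse x T"
  by (simp add: total_recourse_def l1_norm_def sum_nonneg)

lemma opt_body_recourse_nonneg:
  assumes "\<forall>K\<in>set Ks. valid_body K"
  shows "0 \<le> opt_body_recourse Ks"
proof -
  have "\<exists>z. z \<in> body_points (Ks ! (t - 1))" if "t \<in> {1..length Ks}" for t
    using assms that nth_mem[of "t - 1" Ks] by (auto simp: valid_body_def)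
  then obtain z where "\<And>t. t \<in> {1..length Ks} \<Longrightarrow> z t \<in> body_points (Ks ! (t - 1))" by metis
  \<comment> \<open>Points chosen separately at each time, patched to start at 0, show that the
    infimum is over a nonempty set.\<close>
  then have "total_recourse (\<lambda>t. if t = 0 then 0 else z t) (length Ks) \<in>
      {total_recourse y (length Ks) | y.
         y 0 = 0 \<and> (\<forall>t\<in>{1..length Ks}. y t \<in> body_points (Ks ! (t - 1)))}"
    by (intro CollectI exI[of _ "\<lambda>t. if t = 0 then 0 else z t"] conjI) auto
  then have "{total_recourse y (length Ks) | y.
      y 0 = 0 \<and> (\<forall>t\<in>{1..length Ks}. y t \<in> body_points (Ks ! (t - 1)))} \<noteq> {}"
    by (rule ex_in_conv[THEN iffD1, OF exI])
  then show ?thesis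
    unfolding opt_body_recourse_def
    by (rule cInf_greatest) (auto simp: total_recourse_nonneg)
qed

text \<open>Each integral solution is a fractional one of the same recourse, so the integral infimum
  is over a subset. Comparing real infima also needs that subset nonempty and the larger set bounded
  below.\<close>

lemma opt_body_recourse_le_opt_recourse:
  assumes "\<forall>r\<in>set rs. valid_request (packing_polytope M) r"
  shows "opt_body_recourse (map (chasing_body M) rs) \<le> opt_recourse (packing_polytope M) rs"
proof -
  let ?P = "packing_polytope M"
  define ok where "ok t S \<longleftrightarrow> S \<subseteq> ground (rs ! (t - 1)) \<and>
    indicator_vec S \<in> restrict_polytope ?P (ground (rs ! (t - 1))) \<and>
    target (rs ! (t - 1)) \<le> objective (rs ! (t - 1)) S" for t S
  let ?I = "{total_recourse (\<lambda>t. indicator_vec (S t)) (length rs) | S.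
    S 0 = {} \<and> (\<forall>t\<in>{1..length rs}. ok t (S t))}"
  let ?J = "{total_recourse y (length (map (chasing_body M) rs)) | y. y 0 = 0 \<and>
    (\<forall>t\<in>{1..length (map (chasing_body M) rs)}. y t \<in> body_points (map (chasing_body M) rs ! (t - 1)))}"
  have valid: "valid_request ?P (rs ! (t - 1))" if "t \<in> {1..length rs}" for t
    using that assms nth_mem[of "t - 1" rs] by auto
  have "\<exists>S. ok t S" if "t \<in> {1..length rs}" for t
    using valid[OF that] unfolding ok_def by (rule valid_request_witness) blast
  then obtain Z where "\<And>t. t \<in> {1..length rs} \<Longrightarrow> ok t (Z t)" by metis
  then have "total_recourse (\<lambda>t. indicator_vec (if t = 0 then {} else Z t)) (length rs) \<in> ?I"
    by (intro CollectI exI[of _ "\<lambda>t. if t = 0 then {} else Z t"] conjI) auto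
  then have "?I \<noteq> {}" by (rule ex_in_conv[THEN iffD1, OF exI])
  moreover have "bdd_below ?J"
    using total_recourse_nonneg by (intro bdd_belowI[of _ 0]) auto
  moreover have "?I \<subseteq> ?J"
  proof
    fix v assume "v \<in> ?I"
    then obtain S where v: "v = total_recourse (\<lambda>t. indicator_vec (S t)) (length rs)"
      and S: "S 0 = {}" "\<And>t. t \<in> {1..length rs} \<Longrightarrow> ok t (S t)" by blast
    have "indicator_vec (S t) \<in> body_points (map (chasing_body M) rs ! (t - 1))"
      if "t \<in> {1..length rs}" for t
    proof -
      have "indicator_vec (S t) \<in> body_points (chasing_body M (rs ! (t - 1)))"
        using valid[OF that] S(2)[OF that] unfolding ok_def valid_request_def
        by (intro indicator_vec_in_chasing_body) auto
      moreover have "map (chasing_body M) rs ! (t - 1) = chasing_body M (rs ! (t - 1))"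
        using that by (intro nth_map) auto
      ultimately show ?thesis by simp
    qed
    moreover have "indicator_vec (S 0) = 0"
      by (simp add: S(1) indicator_vec_def vec_eq_iff)
    ultimately show "v \<in> ?J"
      unfolding v by (intro CollectI exI[of _ "\<lambda>t. indicator_vec (S t)"]) auto
  qed
  ultimately have "Inf ?J \<le> Inf ?I" by (rule cInf_superset_mono)
  then show ?thesis
    unfolding opt_body_recourse_def opt_recourse_def ok_def Let_def .
qed

section \<open>Approximation at relaxed points\<close>

lemma relaxed_chasing_body_multilinear_ext_ge:
  assumes valid: "valid_request P r" and "0 < \<epsilon>"
    and x: "x \<in> relaxed_body_points \<epsilon> (chasing_body M r)"
    and sign: "\<epsilon> \<le> 1 - 1 / exp 1 \<or> 0 \<le> target r"
  shows "multilinear_ext (ground r) (objective r) (one_minus_exp x)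
    \<ge> (1 - 1 / exp 1 - \<epsilon>) * target r"
proof -
  let ?f = "objective r" and ?U = "ground r" and ?V = "target r"
  have mono: "mono_on (Pow ?U) ?f" and nonneg: "\<And>S. S \<subseteq> ?U \<Longrightarrow> 0 \<le> ?f S"
    using valid by (auto simp: valid_request_def)
  have x0: "0 \<le> x" using x by (simp add: relaxed_body_points_def)
  \<comment> \<open>If ratio and target are nonnegative, the differential inequality applies with
    rate \<open>1 - \<epsilon>\<close>. Otherwise \<open>sign\<close> leaves exactly one of them
    negative, and a nonpositive bound follows from nonnegativity of the objective.\<close>
  show ?thesis
  proof (cases "\<epsilon> \<le> 1 - 1 / exp 1 \<and> 0 \<le> ?V")
    case True
    have "0 < 1 / exp (1 :: real)" by simp
    then have eps: "\<epsilon> < 1" using True by linarith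
    have "(1 - \<epsilon>) * (?V - ?f R) \<le> (\<Sum>i\<in>?U. marginal ?f i R * x $ i)" if "R \<subseteq> ?U" for R
    proof (cases "?f R < ?V")
      case True
      \<comment> \<open>Rows are normalised by the gap \<open>V - f R\<close>, so the relaxation
        scales this gap and not \<open>V\<close> itself, as the differential inequality
        requires.\<close>
      then have "1 - \<epsilon> \<le> cover_row r R \<bullet> x"
        using x that by (auto simp: relaxed_body_points_def chasing_body_def)
      then show ?thesis
        using True by (simp add: cover_row_inner pos_le_divide_eq)
    next
      case False
      \<comment> \<open>The body has omitted the row of such an \<open>R\<close>; signs alone
        suffice here.\<close>
      have "(1 - \<epsilon>) * (?V - ?f R) \<le> 0"
        using False eps by (intro mult_nonneg_nonpos) auto
      also have "0 \<le> (\<Sum>i\<in>?U. marginal ?f i R * x $ i)"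
        using x0 that by (intro sum_nonneg mult_nonneg_nonneg marginal_nonneg[OF mono])
          (auto simp: less_eq_vec_def)
      finally show ?thesis .
    qed
    then have "(1 - exp (- (1 - \<epsilon>))) * ?V \<le> multilinear_ext ?U ?f (one_minus_exp x)"
      using x0 nonneg by (intro multilinear_ext_one_minus_exp_ge) auto
    moreover have "(1 - 1 / exp 1 - \<epsilon>) * ?V \<le> (1 - exp (- (1 - \<epsilon>))) * ?V"
      using True eps \<open>0 < \<epsilon>\<close> by (intro mult_right_mono one_minus_exp_ratio_ge) auto
    ultimately show ?thesis by linarith
  next
    case False
    then have "(1 - 1 / exp 1 - \<epsilon>) * ?V \<le> 0"
      using sign by (auto simp: mult_le_0_iff)
    also have "0 = multilinear_ext ?U (\<lambda>_. 0) (one_minus_exp x)" by simp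
    also have "\<dots> \<le> multilinear_ext ?U ?f (one_minus_exp x)"
      using nonneg one_minus_exp_bounds[OF x0] by (intro multilinear_ext_mono_fun) auto
    finally show ?thesis .
  qed
qed

lemma olog_mono:
  assumes "0 < \<epsilon>" "m \<le> n"
  shows "olog (real m / \<epsilon>) \<le> olog (real n / \<epsilon>)"
proof (cases "m = 0")
  case False
  then have "ln (real m / \<epsilon>) \<le> ln (real n / \<epsilon>)"
    using assms by (subst ln_le_cancel_iff) (auto simp: divide_right_mono)
  then show ?thesis by (simp add: olog_def)
\<comment> \<open>For \<open>m = 0\<close> the truncation yields 1, the least value of
  \<open>olog\<close>.\<close>
qed (simp add: olog_def)

text \<open>The O-constant is the constant \<open>c\<close> of \<open>B\<close>, and determinism is
  built in, as outputs are a function of the requests seen. The last hypothesis excludes a negative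
  ratio times a negative target, a positive bound that fails for the zero objective.\<close>

theorem mainTheorem3:
  fixes \<epsilon> c :: real
    and M :: "(real ^ 'e::finite) set"
    and B :: "'e body list \<Rightarrow> real ^ 'e"
    and rs :: "'e request list"
  defines "P \<equiv> packing_polytope M"
    and "x \<equiv> trajectory (chasing_algorithm B M) rs"
  assumes "0 < \<epsilon>" and "0 \<le> c"
    and "nonneg_rows M" and "P \<subseteq> cbox 0 1"
    and "positive_body_chaser c \<epsilon> B"
    and "\<forall>r\<in>set rs. valid_request P r"
    and "\<epsilon> \<le> 1 - 1 / exp 1 \<or> (\<forall>r\<in>set rs. 0 \<le> target r)"
  shows "feasible_outputs P rs x \<and>
     approximate_on (1 - 1 / exp 1 - \<epsilon>) rs x \<and>
     competitive_on (c * (1 / \<epsilon> * olog (real (max_ground_size rs) / \<epsilon>))) P rs x \<and>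
     (\<forall>t\<in>{1..length rs}. let r = rs ! (t - 1) in
        multilinear_ext (ground r) (objective r) (one_minus_exp (x t))
          \<ge> (1 - 1 / exp 1 - \<epsilon>) * target r)"
proof -
  let ?Ks = "map (chasing_body M) rs"
  let ?\<alpha> = "1 - 1 / exp 1 - \<epsilon>"
  \<comment> \<open>\<open>map\<close> commutes with prefixes, so the outputs are those of
    \<open>B\<close> on the bodies.\<close>
  have x_eq: "x = trajectory B ?Ks"
    by (rule ext) (simp add: x_def trajectory_def chasing_algorithm_def take_map)
  have bodies: "\<forall>K\<in>set ?Ks. valid_body K"
    using assms(5,8) by (auto simp: P_def intro: valid_body_chasing_body)
  then have chase: "\<And>t. t \<in> {1..length ?Ks} \<Longrightarrow> x t \<in> relaxed_body_points \<epsilon> (?Ks ! (t - 1))"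
    and rec: "total_recourse x (length ?Ks)
      \<le> c * (1 / \<epsilon> * olog (real (covering_sparsity ?Ks) / \<epsilon>)) * opt_body_recourse ?Ks"
    using assms(7) unfolding positive_body_chaser_def x_eq by blast+
  have pt: "x t \<in> relaxed_body_points \<epsilon> (chasing_body M (rs ! (t - 1)))"
    "rs ! (t - 1) \<in> set rs" if "t \<in> {1..length rs}" for t
  proof -
    have "t - 1 < length rs" using that by auto
    then show "x t \<in> relaxed_body_points \<epsilon> (chasing_body M (rs ! (t - 1)))" "rs ! (t - 1) \<in> set rs"
      using chase[of t] that by auto
  qed
  \<comment> \<open>Only covering rows are relaxed; packing rows and zero coordinates hold
    exactly.\<close>
  have feas: "x t \<in> restrict_polytope P (ground (rs ! (t - 1)))" if "t \<in> {1..length rs}" for t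
    using pt(1)[OF that]
    by (auto simp: relaxed_body_points_def chasing_body_def restrict_polytope_def P_def
        packing_polytope_def)
  have strong: "multilinear_ext (ground (rs ! (t - 1))) (objective (rs ! (t - 1))) (one_minus_exp (x t))
      \<ge> ?\<alpha> * target (rs ! (t - 1))" if "t \<in> {1..length rs}" for t
    using pt[OF that] assms(3,8,9) by (intro relaxed_chasing_body_multilinear_ext_ge) auto
  have weak: "multilinear_ext (ground (rs ! (t - 1))) (objective (rs ! (t - 1))) (x t)
      \<ge> ?\<alpha> * target (rs ! (t - 1))" if "t \<in> {1..length rs}" for t
  proof -
    \<comment> \<open>The box makes the coordinates probabilities, as monotonicity of the
      multilinear extension requires.\<close>
    have "x t \<in> cbox 0 1" using feas[OF that] assms(6) by (auto simp: restrict_polytope_def)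
    then have "0 \<le> x t" "\<And>i. x t $ i \<le> 1"
      by (auto simp: mem_box_cart less_eq_vec_def)
    moreover have "mono_on (Pow (ground (rs ! (t - 1)))) (objective (rs ! (t - 1)))"
      using pt(2)[OF that] assms(8) by (auto simp: valid_request_def)
    ultimately have "multilinear_ext (ground (rs ! (t - 1))) (objective (rs ! (t - 1))) (one_minus_exp (x t))
      \<le> multilinear_ext (ground (rs ! (t - 1))) (objective (rs ! (t - 1))) (x t)"
      by (intro multilinear_ext_mono) (auto simp: one_minus_exp_bounds)
    then show ?thesis using strong[OF that] by linarith
  qed
  have "total_recourse x (length rs)
      \<le> c * (1 / \<epsilon> * olog (real (covering_sparsity ?Ks) / \<epsilon>)) * opt_body_recourse ?Ks"
    using rec by simp
  also have "\<dots> \<le> c * (1 / \<epsilon> * olog (real (max_ground_size rs) / \<epsilon>)) * opt_recourse P rs"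
  proof (rule mult_mono)
    show "c * (1 / \<epsilon> * olog (real (covering_sparsity ?Ks) / \<epsilon>))
        \<le> c * (1 / \<epsilon> * olog (real (max_ground_size rs) / \<epsilon>))"
      using assms(3,4) by (intro mult_left_mono olog_mono covering_sparsity_chasing_body_le) auto
    show "opt_body_recourse ?Ks \<le> opt_recourse P rs"
      using assms(8) unfolding P_def by (rule opt_body_recourse_le_opt_recourse)
    show "0 \<le> c * (1 / \<epsilon> * olog (real (max_ground_size rs) / \<epsilon>))"
      using assms(3,4) by (intro mult_nonneg_nonneg) (auto simp: olog_def)
    show "0 \<le> opt_body_recourse ?Ks" using bodies by (rule opt_body_recourse_nonneg)
  qed
  finally show ?thesis
    using feas strong weak
    by (simp add: feasible_outputs_def approximate_on_def competitive_on_def Let_def)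
qed

end
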